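(* There are $14$ nontrivial varieties of groupoids defined by a single linear identity of length $6$, namely those defined by the following identities: $(xy)z=(yx)z$; $(xy)z=(zy)x$; $(xy)z=(xz)y$; $(xy)z=(zx)y$; $(xy)z=x(yz)$; $(xy)z=y(xz)$; $(xy)z=z(yx)$; $(xy)z=x(zy)$; $(xy)z=z(xy)$; $(xy)z=y(zx)$; $x(yz)=y(xz)$; $x(yz)=z(yx)$; $x(yz)=x(zy)$; $x(yz)=z(xy)$. These $14$ varieties are in a general position with respect to inclusion, i.e., none of these varieties is contained in the union of the remaining $13$ varieties.
   Context: A groupoid is a set with one binary operation. A groupoid identity $u=v$ is linear of length $6$ if the same $3$ variables occur in both terms $u$ and $v$, each exactly once on each side. The variety defined by an identity is the class of all groupoids satisfying it; it is nontrivial here if it is not the class of all groupoids. *)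

theory Defs
  imports Main
begin

(* A groupoid (magma) with underlying set contained in the type 'a.  Values of mult outside
   the carrier carry no information; none of the notions below depends on them. *)
record 'a groupoid =
  carrier :: "'a set"
  mult :: "'a \<Rightarrow> 'a \<Rightarrow> 'a"

definition is_groupoid :: "'a groupoid \<Rightarrow> bool" where
  "is_groupoid G \<longleftrightarrow> (\<forall>a \<in> carrier G. \<forall>b \<in> carrier G. mult G a b \<in> carrier G)"

datatype trm = Var nat | Prod trm trm (infixl "\<cdot>" 70)

type_synonym identity = "trm \<times> trm"

abbreviation identity_of :: "trm \<Rightarrow> trm \<Rightarrow> identity" (infix "\<approx>" 50) where
  "u \<approx> v \<equiv> (u, v)"

(* The word of variable occurrences, read from left to right. *)
fun occurrences :: "trm \<Rightarrow> nat list" where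
  "occurrences (Var i) = [i]"
| "occurrences (s \<cdot> t) = occurrences s @ occurrences t"

definition linear_of_length_6 :: "identity \<Rightarrow> bool" where
  "linear_of_length_6 e \<longleftrightarrow>
     distinct (occurrences (fst e)) \<and> distinct (occurrences (snd e)) \<and>
     set (occurrences (fst e)) = set (occurrences (snd e)) \<and>
     card (set (occurrences (fst e))) = 3"

fun eval :: "'a groupoid \<Rightarrow> (nat \<Rightarrow> 'a) \<Rightarrow> trm \<Rightarrow> 'a" where
  "eval G \<rho> (Var i) = \<rho> i"
| "eval G \<rho> (s \<cdot> t) = mult G (eval G \<rho> s) (eval G \<rho> t)"

definition satisfies :: "'a groupoid \<Rightarrow> identity \<Rightarrow> bool" where
  "satisfies G e \<longleftrightarrow>
     (\<forall>\<rho>. (\<forall>i. \<rho> i \<in> carrier G) \<longrightarrow> eval G \<rho> (fst e) = eval G \<rho> (snd e))"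

(* The variety relative to the universe 'a: HOL has no class of all groupoids, so the classes
   are represented by the sets of their members with underlying set contained in 'a, where 'a
   is an arbitrary type. *)
definition variety :: "identity \<Rightarrow> 'a groupoid set" where
  "variety e = {G. is_groupoid G \<and> satisfies G e}"

definition nontrivial :: "'a groupoid set \<Rightarrow> bool" where
  "nontrivial V \<longleftrightarrow> V \<noteq> {G. is_groupoid G}"

definition listed_identities :: "identity set" where
  "listed_identities =
    (let x = Var 0; y = Var 1; z = Var 2 in
      {(x \<cdot> y) \<cdot> z \<approx> (y \<cdot> x) \<cdot> z,
       (x \<cdot> y) \<cdot> z \<approx> (z \<cdot> y) \<cdot> x,
       (x \<cdot> y) \<cdot> z \<approx> (x \<cdot> z) \<cdot> y,
       (x \<cdot> y) \<cdot> z \<approx> (z \<cdot> x) \<cdot> y,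
       (x \<cdot> y) \<cdot> z \<approx> x \<cdot> (y \<cdot> z),
       (x \<cdot> y) \<cdot> z \<approx> y \<cdot> (x \<cdot> z),
       (x \<cdot> y) \<cdot> z \<approx> z \<cdot> (y \<cdot> x),
       (x \<cdot> y) \<cdot> z \<approx> x \<cdot> (z \<cdot> y),
       (x \<cdot> y) \<cdot> z \<approx> z \<cdot> (x \<cdot> y),
       (x \<cdot> y) \<cdot> z \<approx> y \<cdot> (z \<cdot> x),
       x \<cdot> (y \<cdot> z) \<approx> y \<cdot> (x \<cdot> z),
       x \<cdot> (y \<cdot> z) \<approx> z \<cdot> (y \<cdot> x),
       x \<cdot> (y \<cdot> z) \<approx> x \<cdot> (z \<cdot> y),
       x \<cdot> (y \<cdot> z) \<approx> z \<cdot> (x \<cdot> y)})"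

end

theory Submission
  imports Defs "HOL-Library.Countable"
begin

text \<open>
  Up to renaming of variables and exchange of the two sides, a linear identity of length 6 is
  \<open>t \<approx> t\<close> or one of the fourteen listed ones.  To separate these, take a groupoid in which every
  product of four elements is zero: generators, formal products of two generators, and values
  \<open>(ab)c = l a b c\<close>, \<open>a(bc) = r a b c\<close> of the products of three.  Such a groupoid satisfies a linear
  identity of length 6 as soon as its instances at generators hold, so \<open>l\<close> and \<open>r\<close> can be chosen
  to make a single listed identity true.
\<close>

section \<open>Classification of the identities\<close>

fun rename :: "(nat \<Rightarrow> nat) \<Rightarrow> trm \<Rightarrow> trm" where
  "rename \<sigma> (Var i) = Var (\<sigma> i)"
| "rename \<sigma> (s \<cdot> t) = rename \<sigma> s \<cdot> rename \<sigma> t"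

lemma eval_rename: "eval G \<rho> (rename \<sigma> t) = eval G (\<rho> \<circ> \<sigma>) t"
  by (induction t) auto

lemma eval_cong:
  "(\<And>i. i \<in> set (occurrences t) \<Longrightarrow> \<rho> i = \<rho>' i) \<Longrightarrow> eval G \<rho> t = eval G \<rho>' t"
  by (induction t) auto

text \<open>An assignment composed with \<open>\<sigma>\<close> evaluates the original terms, and
  injectivity allows the reverse passage. It is asked only on the occurring variables because the
  renaming in \<open>linear_rename\<close> is constant from 2 on.\<close>

lemma satisfies_rename:
  fixes G :: "'a groupoid"
  assumes inj: "inj_on \<sigma> (set (occurrences s) \<union> set (occurrences t))"
  shows "satisfies G (rename \<sigma> s \<approx> rename \<sigma> t) \<longleftrightarrow> satisfies G (s \<approx> t)"
proof
  let ?A = "set (occurrences s) \<union> set (occurrences t)"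
  assume L: "satisfies G (rename \<sigma> s \<approx> rename \<sigma> t)"
  show "satisfies G (s \<approx> t)"
    unfolding satisfies_def
  proof (intro allI impI)
    fix \<rho> :: "nat \<Rightarrow> 'a" assume \<rho>: "\<forall>i. \<rho> i \<in> carrier G"
    \<comment> \<open>Off the image of \<open>?A\<close> the inverse is arbitrary, but
      \<open>\<rho>\<close> maps every index into the carrier, so \<open>\<rho>'\<close> is still an
      admissible assignment.\<close>
    define \<rho>' where "\<rho>' = \<rho> \<circ> inv_into ?A \<sigma>"
    have "eval G \<rho>' (rename \<sigma> s) = eval G \<rho>' (rename \<sigma> t)"
      using L \<rho> by (auto simp: satisfies_def \<rho>'_def)
    moreover have "(\<rho>' \<circ> \<sigma>) i = \<rho> i" if "i \<in> ?A" for i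
      using inv_into_f_f[OF inj that] by (simp add: \<rho>'_def)
    then have "eval G (\<rho>' \<circ> \<sigma>) s = eval G \<rho> s" "eval G (\<rho>' \<circ> \<sigma>) t = eval G \<rho> t"
      by (auto intro!: eval_cong)
    ultimately show "eval G \<rho> (fst (s \<approx> t)) = eval G \<rho> (snd (s \<approx> t))"
      by (simp add: eval_rename)
  qed
qed (auto simp: satisfies_def eval_rename)

lemma variety_rename:
  "inj_on \<sigma> (set (occurrences s) \<union> set (occurrences t)) \<Longrightarrow>
    variety (rename \<sigma> s \<approx> rename \<sigma> t) = variety (s \<approx> t)"
  by (simp add: variety_def satisfies_rename)

lemma variety_sym: "variety (s \<approx> t) = variety (t \<approx> s)"
  by (auto simp: variety_def satisfies_def)

lemma not_nontrivial_variety_refl: "\<not> nontrivial (variety (t \<approx> t))"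
  by (simp add: nontrivial_def variety_def satisfies_def)

abbreviation lassoc :: "nat \<Rightarrow> nat \<Rightarrow> nat \<Rightarrow> trm" where
  "lassoc a b c \<equiv> Var a \<cdot> Var b \<cdot> Var c"

abbreviation rassoc :: "nat \<Rightarrow> nat \<Rightarrow> nat \<Rightarrow> trm" where
  "rassoc a b c \<equiv> Var a \<cdot> (Var b \<cdot> Var c)"

lemma occurrences_ne: "occurrences t \<noteq> []"
  by (induction t) auto

lemma occurrences_1: "occurrences t = [a] \<longleftrightarrow> t = Var a"
  by (cases t) (auto simp: append_eq_Cons_conv occurrences_ne)

lemma occurrences_2: "occurrences t = [a, b] \<longleftrightarrow> t = Var a \<cdot> Var b"
  by (cases t) (auto simp: append_eq_Cons_conv occurrences_ne occurrences_1)

lemma occurrences_3: "occurrences t = [a, b, c] \<longleftrightarrow> t = lassoc a b c \<or> t = rassoc a b c"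
  by (cases t) (auto simp: append_eq_Cons_conv occurrences_ne occurrences_1 occurrences_2)

lemma listed_identities_eq:
  "listed_identities =
    {lassoc 0 1 2 \<approx> lassoc 1 0 2, lassoc 0 1 2 \<approx> lassoc 2 1 0,
     lassoc 0 1 2 \<approx> lassoc 0 2 1, lassoc 0 1 2 \<approx> lassoc 2 0 1,
     lassoc 0 1 2 \<approx> rassoc 0 1 2, lassoc 0 1 2 \<approx> rassoc 1 0 2,
     lassoc 0 1 2 \<approx> rassoc 2 1 0, lassoc 0 1 2 \<approx> rassoc 0 2 1,
     lassoc 0 1 2 \<approx> rassoc 2 0 1, lassoc 0 1 2 \<approx> rassoc 1 2 0,
     rassoc 0 1 2 \<approx> rassoc 1 0 2, rassoc 0 1 2 \<approx> rassoc 2 1 0,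
     rassoc 0 1 2 \<approx> rassoc 0 2 1, rassoc 0 1 2 \<approx> rassoc 2 0 1}"
  by (simp add: listed_identities_def Let_def)

text \<open>The list has only one of the two 3-cycles for each bracketing. The other is its inverse:
  shift the variables cyclically, then exchange the sides.\<close>

lemma variety_cyclic:
  "variety (lassoc 0 1 2 \<approx> lassoc 1 2 0) = variety (lassoc 0 1 2 \<approx> lassoc 2 0 1)"
  "variety (rassoc 0 1 2 \<approx> rassoc 1 2 0) = variety (rassoc 0 1 2 \<approx> rassoc 2 0 1)"
proof -
  \<comment> \<open>The cycle 0 to 1 to 2 to 0 turns the word 2 0 1 into 0 1 2, and 0 1 2 into 1 2
    0.\<close>
  let ?\<sigma> = "\<lambda>i::nat. if i = 0 then 1 else if i = 1 then 2 else (0::nat)"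
  show "variety (lassoc 0 1 2 \<approx> lassoc 1 2 0) = variety (lassoc 0 1 2 \<approx> lassoc 2 0 1)"
    using variety_rename[of ?\<sigma> "lassoc 2 0 1" "lassoc 0 1 2"] variety_sym
    by (auto simp: inj_on_def)
  show "variety (rassoc 0 1 2 \<approx> rassoc 1 2 0) = variety (rassoc 0 1 2 \<approx> rassoc 2 0 1)"
    using variety_rename[of ?\<sigma> "rassoc 2 0 1" "rassoc 0 1 2"] variety_sym
    by (auto simp: inj_on_def)
qed

lemma variety_listed:
  assumes "e \<in> {lassoc 0 1 2 \<approx> lassoc 1 2 0, rassoc 0 1 2 \<approx> rassoc 1 2 0} \<union> listed_identities"
  shows "variety e \<in> variety ` listed_identities"
proof -
  consider "e = (lassoc 0 1 2 \<approx> lassoc 1 2 0)" | "e = (rassoc 0 1 2 \<approx> rassoc 1 2 0)"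
    | "e \<in> listed_identities"
    using assms by blast
  then show ?thesis
  proof cases
    case 1
    show ?thesis
      unfolding 1 variety_cyclic by (rule imageI) (simp add: listed_identities_eq)
  next
    case 2
    show ?thesis
      unfolding 2 variety_cyclic by (rule imageI) (simp add: listed_identities_eq)
  qed (rule imageI)
qed

text \<open>Normal form: numbering the variables in the order in which they occur in
  \<open>s\<close> makes the left word 0 1 2, so only the two bracketings and a permutation
  remain.\<close>

lemma linear_rename:
  assumes lin: "linear_of_length_6 (s \<approx> t)"
  obtains \<sigma> s' t' i j k where
    "inj_on \<sigma> (set (occurrences s') \<union> set (occurrences t'))"
    "s = rename \<sigma> s'" "t = rename \<sigma> t'"
    "s' = lassoc 0 1 2 \<or> s' = rassoc 0 1 2"
    "t' = lassoc i j k \<or> t' = rassoc i j k"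
    "(i, j, k) \<in> {(0,1,2), (0,2,1), (1,0,2), (1,2,0), (2,0,1), (2,1,0)}"
proof -
  have d: "distinct (occurrences s)" "distinct (occurrences t)"
    and st: "set (occurrences s) = set (occurrences t)" and c: "card (set (occurrences s)) = 3"
    using lin by (auto simp: linear_of_length_6_def)
  have "length (occurrences s) = 3" "length (occurrences t) = 3"
    using d st c by (simp_all flip: distinct_card)
  then obtain a b c p q r where s: "occurrences s = [a, b, c]" and t: "occurrences t = [p, q, r]"
    by (auto simp: numeral_3_eq_3 length_Suc_conv)
  define \<sigma> where "\<sigma> = (\<lambda>i::nat. if i = 0 then a else if i = 1 then b else c)"
  have \<sigma>: "\<sigma> 0 = a" "\<sigma> 1 = b" "\<sigma> (Suc 0) = b" "\<sigma> 2 = c" by (auto simp: \<sigma>_def)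
  have abc: "a \<noteq> b" "a \<noteq> c" "b \<noteq> c" using d(1) s by auto
  have "p \<in> {a, b, c}" "q \<in> {a, b, c}" "r \<in> {a, b, c}" "p \<noteq> q" "p \<noteq> r" "q \<noteq> r"
    using st s t d(2) by auto
  then have "(p, q, r) \<in> {(a,b,c), (a,c,b), (b,a,c), (b,c,a), (c,a,b), (c,b,a)}"
    by auto
  also have "\<dots> = (\<lambda>(i, j, k). (\<sigma> i, \<sigma> j, \<sigma> k)) `
      {(0,1,2), (0,2,1), (1,0,2), (1,2,0), (2,0,1), (2,1,0)}"
    by (simp add: \<sigma>)
  finally obtain i j k where ijk: "p = \<sigma> i" "q = \<sigma> j" "r = \<sigma> k"
    and mem: "(i, j, k) \<in> {(0,1,2), (0,2,1), (1,0,2), (1,2,0), (2,0,1), (2,1,0)}"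
    by (elim imageE) (simp split: prod.splits)
  have "s = rename \<sigma> (lassoc 0 1 2) \<or> s = rename \<sigma> (rassoc 0 1 2)"
    using s by (simp add: occurrences_3 \<sigma>)
  then obtain s' where s': "s = rename \<sigma> s'" "s' = lassoc 0 1 2 \<or> s' = rassoc 0 1 2"
    by blast
  have "t = rename \<sigma> (lassoc i j k) \<or> t = rename \<sigma> (rassoc i j k)"
    using t by (simp add: occurrences_3 ijk)
  then obtain t' where t': "t = rename \<sigma> t'" "t' = lassoc i j k \<or> t' = rassoc i j k"
    by blast
  have "set (occurrences s') = {0, 1, 2}" using s'(2) by auto
  moreover have "set (occurrences t') = {i, j, k}" using t'(2) by auto
  moreover have "{i, j, k} = {0, 1, 2}" using mem by (elim insertE emptyE) auto
  moreover have "inj_on \<sigma> {0, 1, 2}"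
    using abc \<sigma> by (simp add: inj_on_def)
  ultimately have "inj_on \<sigma> (set (occurrences s') \<union> set (occurrences t'))"
    by simp
  then show thesis
    by (rule that[OF _ s'(1) t'(1) s'(2) t'(2) mem])
qed

text \<open>In normal form there are twelve right sides. One gives a trivial identity, ten are
  listed, and the remaining 3-cycle is covered by \<open>variety_cyclic\<close>.\<close>

lemma lassoc_variety_listed:
  assumes "linear_of_length_6 (s \<approx> t)" "nontrivial (variety (s \<approx> t) :: 'a groupoid set)"
    and "s = lassoc a b c"
  shows "(variety (s \<approx> t) :: 'a groupoid set) \<in> variety ` listed_identities"
proof -
  obtain \<sigma> s' t' i j k where inj: "inj_on \<sigma> (set (occurrences s') \<union> set (occurrences t'))"
    and st: "s = rename \<sigma> s'" "t = rename \<sigma> t'"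
    and s': "s' = lassoc 0 1 2 \<or> s' = rassoc 0 1 2"
    and t': "t' = lassoc i j k \<or> t' = rassoc i j k"
    and ijk: "(i, j, k) \<in> {(0,1,2), (0,2,1), (1,0,2), (1,2,0), (2,0,1), (2,1,0)}"
    using linear_rename[OF assms(1)] .
  have "s' = lassoc 0 1 2" using s' st assms(3) by auto
  moreover have V: "(variety (s \<approx> t) :: 'a groupoid set) = variety (s' \<approx> t')"
    using variety_rename[OF inj] st by simp
  moreover have "s' \<noteq> t'"
    using assms(2) not_nontrivial_variety_refl unfolding V by metis
  ultimately have "(s' \<approx> t') \<in> insert (lassoc 0 1 2 \<approx> lassoc 1 2 0) listed_identities"
    using t' ijk unfolding listed_identities_eq by (elim insertE disjE emptyE) simp_all
  then show ?thesis
    unfolding V by (intro variety_listed) blast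
qed

text \<open>The same count with six right sides: one trivial, four listed, one 3-cycle equivalent to
  a listed one.\<close>

lemma rassoc_variety_listed:
  assumes "linear_of_length_6 (s \<approx> t)" "nontrivial (variety (s \<approx> t) :: 'a groupoid set)"
    and "s = rassoc a b c" "t = rassoc p q r"
  shows "(variety (s \<approx> t) :: 'a groupoid set) \<in> variety ` listed_identities"
proof -
  obtain \<sigma> s' t' i j k where inj: "inj_on \<sigma> (set (occurrences s') \<union> set (occurrences t'))"
    and st: "s = rename \<sigma> s'" "t = rename \<sigma> t'"
    and s': "s' = lassoc 0 1 2 \<or> s' = rassoc 0 1 2"
    and t': "t' = lassoc i j k \<or> t' = rassoc i j k"
    and ijk: "(i, j, k) \<in> {(0,1,2), (0,2,1), (1,0,2), (1,2,0), (2,0,1), (2,1,0)}"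
    using linear_rename[OF assms(1)] .
  have "s' = rassoc 0 1 2" "t' = rassoc i j k" using s' t' st assms(3,4) by auto
  moreover have V: "(variety (s \<approx> t) :: 'a groupoid set) = variety (s' \<approx> t')"
    using variety_rename[OF inj] st by simp
  moreover have "s' \<noteq> t'"
    using assms(2) not_nontrivial_variety_refl unfolding V by metis
  ultimately have "(s' \<approx> t') \<in> insert (rassoc 0 1 2 \<approx> rassoc 1 2 0) listed_identities"
    using ijk unfolding listed_identities_eq by (elim insertE emptyE) simp_all
  then show ?thesis
    unfolding V by (intro variety_listed) blast
qed

lemma linear_variety_listed:
  assumes lin: "linear_of_length_6 e" and nt: "nontrivial (variety e :: 'a groupoid set)"
  shows "(variety e :: 'a groupoid set) \<in> variety ` listed_identities"
proof -
  obtain s t where e: "e = (s \<approx> t)" by (cases e)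
  have lin': "linear_of_length_6 (t \<approx> s)"
    using lin unfolding e linear_of_length_6_def by auto
  have shape: "(\<exists>a b c. u = lassoc a b c) \<or> (\<exists>a b c. u = rassoc a b c)"
    if "linear_of_length_6 (u \<approx> v)" for u v
    using that by (elim linear_rename) auto
  \<comment> \<open>If only the right side is bracketed to the left, exchanging the sides reduces to
    the first case.\<close>
  consider a b c where "s = lassoc a b c" | a b c where "t = lassoc a b c"
    | a b c p q r where "s = rassoc a b c" "t = rassoc p q r"
    using shape lin lin' unfolding e by metis
  then show ?thesis
  proof cases
    case 1
    then show ?thesis using lassoc_variety_listed lin nt unfolding e by blast
  next
    case 2
    then show ?thesis
      using lassoc_variety_listed[OF lin'] nt unfolding e variety_sym[of s t] by blast
  next
    case 3
    then show ?thesis using rassoc_variety_listed lin nt unfolding e by blast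
  qed
qed

section \<open>Separating groupoids\<close>

text \<open>Countability is what later allows a copy inside any infinite type. The label of a
  \<open>Triple\<close> is a list so that its length can tell the bracketings apart.\<close>

datatype elem = Gen nat | Pair nat nat | Triple "nat list" | Zero

instance elem :: countable
  by countable_datatype

fun nil_mult ::
  "(nat \<Rightarrow> nat \<Rightarrow> nat \<Rightarrow> nat list) \<Rightarrow> (nat \<Rightarrow> nat \<Rightarrow> nat \<Rightarrow> nat list) \<Rightarrow> elem \<Rightarrow> elem \<Rightarrow> elem" where
  "nil_mult l r (Gen a) (Gen b) = Pair a b"
| "nil_mult l r (Pair a b) (Gen c) = Triple (l a b c)"
| "nil_mult l r (Gen a) (Pair b c) = Triple (r a b c)"
| "nil_mult l r _ _ = Zero"

definition nil_groupoid where
  "nil_groupoid l r = \<lparr>carrier = UNIV, mult = nil_mult l r\<rparr>"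

text \<open>If one of the three factors is not a generator, the product has at least four generators
  or involves \<open>Zero\<close>. As both sides of a linear identity have the same variables, they
  then vanish together.\<close>

lemma nil_mult_lassoc:
  "nil_mult l r (nil_mult l r u v) w =
    (case (u, v, w) of (Gen a, Gen b, Gen c) \<Rightarrow> Triple (l a b c) | _ \<Rightarrow> Zero)"
  by (cases u; cases v; cases w) simp_all

lemma nil_mult_rassoc:
  "nil_mult l r u (nil_mult l r v w) =
    (case (u, v, w) of (Gen a, Gen b, Gen c) \<Rightarrow> Triple (r a b c) | _ \<Rightarrow> Zero)"
  by (cases u; cases v; cases w) simp_all

lemmas satisfies_nil_groupoid =
  satisfies_def nil_groupoid_def nil_mult_lassoc nil_mult_rassoc

text \<open>Sending variable \<open>i\<close> to generator \<open>i\<close> is a concrete test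
  assignment, which turns refutation into computation.\<close>

lemma not_satisfies_nil_groupoid:
  "eval (nil_groupoid l r) Gen (fst e) \<noteq> eval (nil_groupoid l r) Gen (snd e) \<Longrightarrow>
    \<not> satisfies (nil_groupoid l r) e"
  by (auto simp: satisfies_def nil_groupoid_def)

definition separates ::
  "(nat \<Rightarrow> nat \<Rightarrow> nat \<Rightarrow> nat list) \<Rightarrow> (nat \<Rightarrow> nat \<Rightarrow> nat \<Rightarrow> nat list) \<Rightarrow> identity \<Rightarrow> bool" where
  "separates l r e \<longleftrightarrow> satisfies (nil_groupoid l r) e \<and>
    (\<forall>e' \<in> listed_identities - {e}. \<not> satisfies (nil_groupoid l r) e')"

lemma separatesI:
  assumes "satisfies (nil_groupoid l r) e"
    and "\<forall>e' \<in> listed_identities. e' = e \<or>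
      eval (nil_groupoid l r) Gen (fst e') \<noteq> eval (nil_groupoid l r) Gen (snd e')"
  shows "separates l r e"
  using assms not_satisfies_nil_groupoid unfolding separates_def by blast

text \<open>
  At the generators \<open>0, 1, 2\<close> a class of products is determined by the position that the identity
  fixes, or, for a 3-cycle, by the cyclically invariant \<open>a\<^sup>2b + b\<^sup>2c + c\<^sup>2a\<close>.  Lists of different
  lengths keep the two bracketings apart.
\<close>

abbreviation word :: "nat \<Rightarrow> nat \<Rightarrow> nat \<Rightarrow> nat list" where
  "word a b c \<equiv> [a, b, c]"

abbreviation cyc :: "nat \<Rightarrow> nat \<Rightarrow> nat \<Rightarrow> nat list" where
  "cyc a b c \<equiv> [a * a * b + b * b * c + c * c * a]"

lemma separates_listed:
  "separates (\<lambda>a b c. [c]) word (lassoc 0 1 2 \<approx> lassoc 1 0 2)"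
  "separates (\<lambda>a b c. [b]) word (lassoc 0 1 2 \<approx> lassoc 2 1 0)"
  "separates (\<lambda>a b c. [a]) word (lassoc 0 1 2 \<approx> lassoc 0 2 1)"
  "separates cyc word (lassoc 0 1 2 \<approx> lassoc 2 0 1)"
  "separates word (\<lambda>a b c. [a, b, c]) (lassoc 0 1 2 \<approx> rassoc 0 1 2)"
  "separates word (\<lambda>a b c. [b, a, c]) (lassoc 0 1 2 \<approx> rassoc 1 0 2)"
  "separates word (\<lambda>a b c. [c, b, a]) (lassoc 0 1 2 \<approx> rassoc 2 1 0)"
  "separates word (\<lambda>a b c. [a, c, b]) (lassoc 0 1 2 \<approx> rassoc 0 2 1)"
  "separates word (\<lambda>a b c. [b, c, a]) (lassoc 0 1 2 \<approx> rassoc 2 0 1)"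
  "separates word (\<lambda>a b c. [c, a, b]) (lassoc 0 1 2 \<approx> rassoc 1 2 0)"
  "separates word (\<lambda>a b c. [c]) (rassoc 0 1 2 \<approx> rassoc 1 0 2)"
  "separates word (\<lambda>a b c. [b]) (rassoc 0 1 2 \<approx> rassoc 2 1 0)"
  "separates word (\<lambda>a b c. [a]) (rassoc 0 1 2 \<approx> rassoc 0 2 1)"
  "separates word cyc (rassoc 0 1 2 \<approx> rassoc 2 0 1)"
  \<comment> \<open>In the six mixed cases \<open>r\<close> undoes the permutation of the identity,
    so each product of three generators still determines its word. On the arrangements of 0, 1, 2,
    \<open>cyc\<close> gives 2 for the even ones and 4 for the odd ones.\<close>
  by (rule separatesI,
      (auto simp: satisfies_nil_groupoid algebra_simps split: elem.split)[1],
      (simp add: listed_identities_eq nil_groupoid_def)[1])+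

lemma ex_separates: "e \<in> listed_identities \<Longrightarrow> \<exists>l r. separates l r e"
  unfolding listed_identities_eq using separates_listed by blast

text \<open>Transport of structure along an injection of the countable carrier into the infinite
  type. The copy lives on the range of that injection, so the two groupoids are isomorphic.\<close>

lemma infinite_groupoid_copy:
  fixes H :: "'b::countable groupoid"
  assumes "infinite (UNIV :: 'a set)" "carrier H = UNIV"
  obtains G :: "'a groupoid" where "is_groupoid G" "\<And>e. satisfies G e \<longleftrightarrow> satisfies H e"
proof -
  obtain g :: "nat \<Rightarrow> 'a" where "inj g"
    using infinite_countable_subset[OF assms(1)] by blast
  define f :: "'b \<Rightarrow> 'a" where "f = g \<circ> to_nat"
  have f: "inj f" unfolding f_def using \<open>inj g\<close> by (simp add: inj_compose)
  define G where "G = \<lparr>carrier = range f, mult = \<lambda>a b. f (mult H (inv f a) (inv f b))\<rparr>"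
  have ev: "eval G (f \<circ> \<rho>) t = f (eval H \<rho> t)" for \<rho> t
    by (induction t) (simp_all add: G_def f)
  have "satisfies G e \<longleftrightarrow> satisfies H e" for e
  proof
    assume "satisfies G e"
    then have "eval G (f \<circ> \<rho>) (fst e) = eval G (f \<circ> \<rho>) (snd e)" for \<rho>
      by (simp add: satisfies_def G_def)
    then show "satisfies H e"
      using f by (simp add: satisfies_def ev inj_eq)
  next
    assume H: "satisfies H e"
    show "satisfies G e"
      unfolding satisfies_def
    proof (intro allI impI)
      fix \<rho> :: "nat \<Rightarrow> 'a" assume "\<forall>i. \<rho> i \<in> carrier G"
      \<comment> \<open>Every assignment into the copy comes from one into \<open>H\<close>, so
        \<open>ev\<close> applies to it.\<close>
      then have "\<rho> = f \<circ> (inv f \<circ> \<rho>)"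
        by (auto simp: G_def f_inv_into_f)
      then show "eval G \<rho> (fst e) = eval G \<rho> (snd e)"
        using H assms(2) ev unfolding satisfies_def by (metis UNIV_I)
    qed
  qed
  moreover have "is_groupoid G" by (simp add: is_groupoid_def G_def)
  ultimately show thesis using that by blast
qed

lemma ex_separating_groupoid:
  assumes "infinite (UNIV :: 'a set)" "e \<in> listed_identities"
  shows "\<exists>G :: 'a groupoid. G \<in> variety e \<and>
    (\<forall>e' \<in> listed_identities - {e}. G \<notin> variety e')"
proof -
  obtain l r where lr: "separates l r e" using ex_separates assms(2) by blast
  have "carrier (nil_groupoid l r) = UNIV" by (simp add: nil_groupoid_def)
  from infinite_groupoid_copy[OF assms(1) this] obtain G :: "'a groupoid"
    where "is_groupoid G" "\<And>e. satisfies G e \<longleftrightarrow> satisfies (nil_groupoid l r) e" by metis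
  then show ?thesis
    using lr unfolding separates_def variety_def by blast
qed

section \<open>Counting the varieties and their general position\<close>

lemma listed_linear: "e \<in> listed_identities \<Longrightarrow> linear_of_length_6 e"
  unfolding listed_identities_eq by (auto simp: linear_of_length_6_def)

lemma card_listed: "card listed_identities = 14"
  unfolding listed_identities_eq by simp

theorem corollary4p6:
  fixes \<V> :: "'a groupoid set set"
  assumes "infinite (UNIV :: 'a set)"
    and "\<V> = {V. nontrivial V \<and> (\<exists>e. linear_of_length_6 e \<and> V = variety e)}"
  shows "card \<V> = 14 \<and> \<V> = variety ` listed_identities \<and>
         (\<forall>V \<in> \<V>. \<not> V \<subseteq> \<Union> (\<V> - {V}))"
proof -
  note sep = ex_separating_groupoid[OF assms(1)]
  have inj: "inj_on (variety :: identity \<Rightarrow> 'a groupoid set) listed_identities"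
  proof (rule inj_onI)
    fix e e' assume "e \<in> listed_identities" "e' \<in> listed_identities"
      and "(variety e :: 'a groupoid set) = variety e'"
    \<comment> \<open>Otherwise the groupoid separating \<open>e\<close> would lie in one of two
      equal varieties but not in the other.\<close>
    then show "e = e'" using sep[of e] by blast
  qed
  have nontriv: "nontrivial (variety e :: 'a groupoid set)" if e: "e \<in> listed_identities" for e
  proof -
    \<comment> \<open>A second listed identity is needed: the groupoid separating it violates
      \<open>e\<close>.\<close>
    have "card listed_identities \<noteq> card {e}" by (simp add: card_listed)
    then have "listed_identities \<noteq> {e}" by metis
    then obtain e' where "e' \<in> listed_identities" "e' \<noteq> e" using e by blast
    then obtain G :: "'a groupoid" where "G \<in> variety e'" "G \<notin> variety e"
      using sep[of e'] e by blast
    moreover from this have "is_groupoid G" by (simp add: variety_def)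
    ultimately show ?thesis unfolding nontrivial_def by blast
  qed
  have eq: "\<V> = variety ` listed_identities"
    unfolding assms(2) using nontriv listed_linear linear_variety_listed by blast
  moreover have "card \<V> = 14"
    unfolding eq by (simp add: card_image[OF inj] card_listed)
  moreover have "\<not> V \<subseteq> \<Union> (\<V> - {V})" if "V \<in> \<V>" for V
  proof -
    obtain e where e: "e \<in> listed_identities" "V = variety e"
      using \<open>V \<in> \<V>\<close> unfolding eq by blast
    obtain G :: "'a groupoid" where G: "G \<in> V"
      \<comment> \<open>A single groupoid avoids all the other varieties at once, hence also their
        union.\<close>
      and sep_G: "\<forall>e' \<in> listed_identities - {e}. G \<notin> variety e'"
      using sep[OF e(1)] e(2) by metis
    have "G \<notin> W" if W: "W \<in> \<V> - {V}" for W
    proof -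
      obtain e' where "e' \<in> listed_identities" "W = variety e'"
        using W unfolding eq by blast
      moreover from this have "e' \<noteq> e" using W e(2) by auto
      ultimately show ?thesis using sep_G by simp
    qed
    then show ?thesis using G by (meson UnionE subsetD)
  qed
  ultimately show ?thesis by blast
qed

end
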